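(* Let $K\subset\mathbb{R}^n$ be a closed convex set, $\mu_0\in K$, and $h\in\mathbb{R}^n$ (a realization of a standard Gaussian vector). For $\sigma\ge0$ let $\mathrm{err}(\sigma)=\|\Pi_K(\mu_0+\sigma h)-\mu_0\|^2$. The following hold. (1) The map $\sigma\mapsto\mathrm{err}(\sigma)$ is non-decreasing on $[0,\infty)$. (2) $0\le\mathrm{err}'(\sigma)\le2\,\mathrm{err}(\sigma)/\sigma$ for a.e. $\sigma>0$; equivalently (for the upper bound), the map $\sigma\mapsto\mathrm{err}(\sigma)/\sigma^2$ is non-increasing on $(0,\infty)$.
   Context: $\Pi_K$ is the metric (Euclidean) projection onto $K$; $\|\cdot\|$ is the Euclidean norm. *)

theory Defs
  imports "HOL-Analysis.Analysis"
begin

text \<open>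
  The metric projection onto a nonempty closed convex set is the library's \<^const>\<open>closest_point\<close>.
  The function is total in \<open>\<sigma>\<close>; only the values at \<open>\<sigma> \<ge> 0\<close> are meaningful.
\<close>

definition proj_err :: "(real ^ 'n) set \<Rightarrow> real ^ 'n \<Rightarrow> real ^ 'n \<Rightarrow> real \<Rightarrow> real" where
  "proj_err K \<mu>\<^sub>0 h \<sigma> = (norm (closest_point K (\<mu>\<^sub>0 + \<sigma> *\<^sub>R h) - \<mu>\<^sub>0))\<^sup>2"

end

(* A continuous monotone function F is differentiable almost everywhere: where its difference
   quotients oscillate across p < q, Vitali coverings of a set E by intervals of slope at most p,
   refined by intervals of slope at least q, give q |E| \<le> p |E| for the outer measure, hence |E| = 0.
   For the projections a and b (relative to the base point) at parameters s < t, adding t and s times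
   the two variational inequalities eliminates h and leaves
   (norm b - norm a) * (t * norm a - s * norm b) \<ge> 0, which contains both monotonicity statements. *)
theory Submission
  imports Defs
begin

section \<open>Differentiability almost everywhere of continuous monotone functions\<close>

text \<open>This is the Vitali covering theorem for balls, read on the line. Keeping only the
  intervals inside \<open>U\<close> leaves the cover fine, because \<open>U\<close> is open.
  Intervals are indexed by endpoint pairs so that \<open>P\<close> can speak of both ends.\<close>

lemma Vitali_covering_intervals:
  fixes E U :: "real set"
  assumes "open U" "E \<subseteq> U"
    and fine: "\<And>x d. x \<in> E \<Longrightarrow> d > 0 \<Longrightarrow>
      \<exists>u v. u < v \<and> x \<in> {u..v} \<and> v - u < d \<and> P u v"
  obtains D where "countable D" "disjoint_family_on (\<lambda>(u, v). {u..v}) D"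
    "\<And>u v. (u, v) \<in> D \<Longrightarrow> u < v \<and> {u..v} \<subseteq> U \<and> P u v"
    "E - (\<Union>(u, v)\<in>D. {u..v}) \<in> null_sets lebesgue"
proof -
  define I where "I = {(u, v). u < v \<and> {u..v} \<subseteq> U \<and> P u v}"
  \<comment> \<open>Each interval is a closed ball: \<open>a\<close> is its midpoint and
    \<open>r\<close> half its length.\<close>
  define a r where "a = (\<lambda>(u::real, v). (u + v) / 2)" and "r = (\<lambda>(u::real, v). (v - u) / 2)"
  have cb: "cball (a i) (r i) = (\<lambda>(u, v). {u..v}) i" for i
    by (cases i) (simp add: a_def r_def cball_eq_atLeastAtMost field_simps)
  have r: "0 < r i" if "i \<in> I" for i
    using that by (auto simp: I_def r_def)
  have S: "\<exists>i. i \<in> I \<and> x \<in> cball (a i) (r i) \<and> r i < d" if xd: "x \<in> E" "0 < d" for x d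
  proof -
    obtain e where e: "e > 0" "ball x e \<subseteq> U"
      using xd(1) assms(1,2) by (meson openE subsetD)
    \<comment> \<open>Length below \<open>e\<close> keeps an interval through \<open>x\<close>
      inside \<open>U\<close>; length below \<open>d\<close> gives the required small
      radius.\<close>
    obtain u v where uv: "u < v" "x \<in> {u..v}" "v - u < min d e" "P u v"
      using fine[OF xd(1), of "min d e"] xd(2) e(1) by auto
    have "{u..v} \<subseteq> ball x e"
      using uv by (auto simp: dist_real_def)
    then have "(u, v) \<in> I" using uv e by (auto simp: I_def)
    then show ?thesis
      unfolding cb using uv by (intro exI[of _ "(u, v)"]) (auto simp: r_def)
  qed
  obtain D where D: "countable D" "D \<subseteq> I"
     "pairwise (\<lambda>i j. disjnt (cball (a i) (r i)) (cball (a j) (r j))) D"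
     "negligible (E - (\<Union>i\<in>D. cball (a i) (r i)))"
    using Vitali_covering_theorem_cballs[of I r E a, OF r S] by blast
  show ?thesis
  proof (rule that[of D])
    show "disjoint_family_on (\<lambda>(u, v). {u..v}) D"
      using D(3) by (auto simp: disjoint_family_on_def pairwise_def disjnt_def cb)
    show "E - (\<Union>(u, v)\<in>D. {u..v}) \<in> null_sets lebesgue"
      using D(4) by (simp add: cb negligible_iff_null_sets)
  qed (use D in \<open>auto simp: I_def\<close>)
qed

text \<open>The outer measure is attained by a Borel superset, which is then null. Outer measure is
  used because the exceptional sets below are not known to be measurable.\<close>

lemma null_sets_lebesgue_outer:
  assumes "outer_measure_of lborel E = 0"
  shows "E \<in> null_sets lebesgue"
proof -
  obtain A where "E \<subseteq> A" "A \<in> sets lborel" "outer_measure_of lborel E = emeasure lborel A"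
    using outer_measure_of_attain[of E lborel] by auto
  with assms show ?thesis
    unfolding null_sets_completion_iff2 by (intro bexI[of _ A]) auto
qed

lemma outer_measure_bounded_finite:
  assumes "E \<subseteq> {-c..c::real}"
  shows "outer_measure_of lborel E < \<infinity>"
proof -
  have "outer_measure_of lborel E \<le> emeasure lborel {-c..c}"
    unfolding outer_measure_of_def using assms by (intro INF_lower) auto
  also have "\<dots> < \<infinity>" by (simp add: emeasure_lborel_Icc_eq)
  finally show ?thesis .
qed

section \<open>Slopes of \<open>F\<close> and its Lebesgue-Stieltjes measure\<close>

locale continuous_mono =
  fixes F :: "real \<Rightarrow> real"
  assumes mono_F: "mono F" and cont_F: "continuous_on UNIV F"
begin

text \<open>Continuity rules out atoms, so including the left endpoint adds no mass.\<close>

lemma emeasure_Icc: "u \<le> v \<Longrightarrow> emeasure (interval_measure F) {u..v} = ennreal (F v - F u)"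
  by (rule emeasure_interval_measure_Icc) (use mono_F cont_F in \<open>auto simp: mono_def\<close>)

text \<open>On disjoint intervals of slope at most \<open>p\<close> inside \<open>U\<close>, the
  Stieltjes mass is at most \<open>p\<close> times the total length. The result is an open set so
  that a second Vitali covering can be carried out inside it.\<close>

lemma small_slope_cover:
  assumes "open U" "E \<subseteq> U" "p \<ge> 0"
    and "\<And>x d. x \<in> E \<Longrightarrow> d > 0 \<Longrightarrow>
      \<exists>u v. u < v \<and> x \<in> {u..v} \<and> v - u < d \<and> F v - F u \<le> p * (v - u)"
  obtains V where "open V" "E - V \<in> null_sets lebesgue"
    "emeasure (interval_measure F) V \<le> ennreal p * emeasure lborel U"
proof -
  obtain D where D: "countable D" "disjoint_family_on (\<lambda>(u, v). {u..v}) D"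
    "\<And>u v. (u, v) \<in> D \<Longrightarrow> u < v \<and> {u..v} \<subseteq> U \<and> F v - F u \<le> p * (v - u)"
    "E - (\<Union>(u, v)\<in>D. {u..v}) \<in> null_sets lebesgue"
    using Vitali_covering_intervals[OF assms(1,2,4)] by metis
  let ?C = "\<lambda>(u, v). {u..v}"
  define V where "V = (\<Union>(u, v)\<in>D. {u<..<v})"
  \<comment> \<open>Replacing closed intervals by their interiors makes \<open>V\<close> open and
    loses only countably many endpoints.\<close>
  have "countable (fst ` D \<union> snd ` D)" using D(1) by auto
  then have "fst ` D \<union> snd ` D \<in> null_sets lebesgue"
    by (intro null_sets_completionI countable_imp_null_set_lborel)
  with D(4) have "(E - (\<Union>i\<in>D. ?C i)) \<union> (fst ` D \<union> snd ` D) \<in> null_sets lebesgue"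
    by (rule null_sets.Un)
  moreover have "E - V \<subseteq> (E - (\<Union>i\<in>D. ?C i)) \<union> (fst ` D \<union> snd ` D)"
    by (fastforce simp: V_def image_iff)
  ultimately have 1: "E - V \<in> null_sets lebesgue"
    by (rule null_sets_completion_subset[rotated])
  have "emeasure (interval_measure F) V \<le> emeasure (interval_measure F) (\<Union>i\<in>D. ?C i)"
  proof (rule emeasure_mono)
    show "V \<subseteq> (\<Union>i\<in>D. ?C i)"
      unfolding V_def by (intro UN_mono) auto
    show "(\<Union>i\<in>D. ?C i) \<in> sets (interval_measure F)"
      by (rule sets.countable_UN') (use D(1) in auto)
  qed
  also have "\<dots> = (\<integral>\<^sup>+i. emeasure (interval_measure F) (?C i) \<partial>count_space D)"
    by (rule emeasure_UN_countable) (use D in auto)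
  also have "\<dots> \<le> (\<integral>\<^sup>+i. ennreal p * emeasure lborel (?C i) \<partial>count_space D)"
  proof (rule nn_integral_mono)
    fix i assume "i \<in> space (count_space D)"
    then show "emeasure (interval_measure F) (?C i) \<le> ennreal p * emeasure lborel (?C i)"
      using D(3)[of "fst i" "snd i"] \<open>p \<ge> 0\<close>
      by (cases i) (auto simp: emeasure_Icc ennreal_mult[symmetric] intro!: ennreal_leI)
  qed
  also have "\<dots> = ennreal p * (\<integral>\<^sup>+i. emeasure lborel (?C i) \<partial>count_space D)"
    by (rule nn_integral_cmult) auto
  also have "(\<integral>\<^sup>+i. emeasure lborel (?C i) \<partial>count_space D) = emeasure lborel (\<Union>i\<in>D. ?C i)"
    by (rule emeasure_UN_countable[symmetric]) (use D in auto)
  also have "\<dots> \<le> emeasure lborel U"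
    by (rule emeasure_mono) (use D(3) assms(1) in auto)
  finally have 2: "emeasure (interval_measure F) V \<le> ennreal p * emeasure lborel U"
    by (simp add: mult_left_mono)
  show ?thesis
    by (rule that[OF _ 1 2]) (auto simp: V_def)
qed

text \<open>Disjoint intervals of slope at least \<open>q\<close> inside \<open>V\<close> cover
  almost all of \<open>E\<close>; \<open>q\<close> times their total length is at most their
  Stieltjes mass, hence at most that of \<open>V\<close>.\<close>

lemma large_slope_cover:
  assumes "open V" "E - V \<in> null_sets lebesgue" "q \<ge> 0"
    and fine: "\<And>x d. x \<in> E \<Longrightarrow> d > 0 \<Longrightarrow>
      \<exists>u v. u < v \<and> x \<in> {u..v} \<and> v - u < d \<and> q * (v - u) \<le> F v - F u"
  shows "ennreal q * outer_measure_of lborel E \<le> emeasure (interval_measure F) V"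
proof -
  have *: "\<exists>u v. u < v \<and> x \<in> {u..v} \<and> v - u < d \<and> q * (v - u) \<le> F v - F u"
    if "x \<in> E \<inter> V" "d > 0" for x d using fine that by blast
  obtain D where D: "countable D" "disjoint_family_on (\<lambda>(u, v). {u..v}) D"
    "\<And>u v. (u, v) \<in> D \<Longrightarrow> u < v \<and> {u..v} \<subseteq> V \<and> q * (v - u) \<le> F v - F u"
    "E \<inter> V - (\<Union>(u, v)\<in>D. {u..v}) \<in> null_sets lebesgue"
    using Vitali_covering_intervals[OF assms(1) Int_lower2 *] by metis
  let ?C = "\<lambda>(u, v). {u..v}"
  have "(E \<inter> V - (\<Union>i\<in>D. ?C i)) \<union> (E - V) \<in> null_sets lebesgue"
    using D(4) assms(2) by (rule null_sets.Un)
  \<comment> \<open>A Borel null superset of the uncovered points is needed, since the outer measure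
    is an infimum over Borel sets.\<close>
  then obtain N where N: "N \<in> null_sets lborel" "(E \<inter> V - (\<Union>i\<in>D. ?C i)) \<union> (E - V) \<subseteq> N"
    unfolding null_sets_completion_iff2 by auto
  have [measurable]: "(\<Union>i\<in>D. ?C i) \<in> sets borel"
    by (rule sets.countable_UN') (use D(1) in auto)
  have "E \<subseteq> (\<Union>i\<in>D. ?C i) \<union> N" using N(2) by blast
  then have "outer_measure_of lborel E \<le> emeasure lborel ((\<Union>i\<in>D. ?C i) \<union> N)"
    unfolding outer_measure_of_def using N(1) by (intro INF_lower) auto
  also have "\<dots> = emeasure lborel (\<Union>i\<in>D. ?C i)"
    using N(1) by (intro emeasure_Un_null_set) auto
  also have "\<dots> = (\<integral>\<^sup>+i. emeasure lborel (?C i) \<partial>count_space D)"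
    by (rule emeasure_UN_countable) (use D in auto)
  finally have "ennreal q * outer_measure_of lborel E \<le>
      ennreal q * (\<integral>\<^sup>+i. emeasure lborel (?C i) \<partial>count_space D)"
    by (rule mult_left_mono) simp
  also have "\<dots> = (\<integral>\<^sup>+i. ennreal q * emeasure lborel (?C i) \<partial>count_space D)"
    by (rule nn_integral_cmult[symmetric]) auto
  also have "\<dots> \<le> (\<integral>\<^sup>+i. emeasure (interval_measure F) (?C i) \<partial>count_space D)"
  proof (rule nn_integral_mono)
    fix i assume "i \<in> space (count_space D)"
    then show "ennreal q * emeasure lborel (?C i) \<le> emeasure (interval_measure F) (?C i)"
      using D(3)[of "fst i" "snd i"] \<open>q \<ge> 0\<close>
      by (cases i) (auto simp: emeasure_Icc ennreal_mult[symmetric] intro!: ennreal_leI)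
  qed
  also have "\<dots> = emeasure (interval_measure F) (\<Union>i\<in>D. ?C i)"
    by (rule emeasure_UN_countable[symmetric]) (use D in auto)
  also have "\<dots> \<le> emeasure (interval_measure F) V"
    by (rule emeasure_mono) (use D(3) assms(1) in auto)
  finally show ?thesis .
qed

text \<open>The two covers are chained through an open \<open>U\<close> whose measure barely exceeds
  that of \<open>E\<close>. Boundedness of \<open>E\<close> makes its outer measure finite, so it
  can be cancelled.\<close>

lemma null_two_slopes:
  assumes "E \<subseteq> {-c..c}" "0 \<le> p" "p < q"
    and small: "\<And>x d. x \<in> E \<Longrightarrow> d > 0 \<Longrightarrow>
      \<exists>u v. u < v \<and> x \<in> {u..v} \<and> v - u < d \<and> F v - F u \<le> p * (v - u)"
    and large: "\<And>x d. x \<in> E \<Longrightarrow> d > 0 \<Longrightarrow>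
      \<exists>u v. u < v \<and> x \<in> {u..v} \<and> v - u < d \<and> q * (v - u) \<le> F v - F u"
  shows "E \<in> null_sets lebesgue"
proof -
  define m where "m = enn2real (outer_measure_of lborel E)"
  have m: "outer_measure_of lborel E = ennreal m" "m \<ge> 0"
    using outer_measure_bounded_finite[OF assms(1)] by (auto simp: m_def)
  have "q * m \<le> p * m + e" if "e > 0" for e
  proof -
    \<comment> \<open>The denominator \<open>p + 1\<close> gives p * \<epsilon> \<le> e and stays
      positive when p = 0.\<close>
    define \<epsilon> where "\<epsilon> = e / (p + 1)"
    have \<epsilon>: "\<epsilon> > 0" "p * \<epsilon> \<le> e" using that assms(2) by (auto simp: \<epsilon>_def field_simps)
    \<comment> \<open>Outer regularity applies to Borel sets, so \<open>E\<close> is first replaced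
      by a Borel hull of the same measure.\<close>
    obtain A where A: "E \<subseteq> A" "A \<in> sets lborel" "emeasure lborel A = ennreal m"
      using outer_measure_of_attain[of E lborel] m by auto
    obtain U where U: "open U" "A \<subseteq> U" "emeasure lborel (U - A) < ennreal \<epsilon>"
      using outer_regular_lborel[of A \<epsilon>] A(2) \<epsilon>(1) by auto
    have "emeasure lborel U = emeasure lborel A + emeasure lborel (U - A)"
      using A U by (subst plus_emeasure) (auto intro!: arg_cong[where f = "emeasure lborel"])
    also have "\<dots> \<le> ennreal m + ennreal \<epsilon>"
      using A(3) U(3) by (auto intro!: add_left_mono)
    finally have U': "emeasure lborel U \<le> ennreal (m + \<epsilon>)"
      using m \<epsilon> by simp
    obtain V where V: "open V" "E - V \<in> null_sets lebesgue"
      "emeasure (interval_measure F) V \<le> ennreal p * emeasure lborel U"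
      using small_slope_cover[OF U(1) _ assms(2) small] A U by blast
    have "ennreal (q * m) = ennreal q * outer_measure_of lborel E"
      using m assms by (simp add: ennreal_mult)
    also have "\<dots> \<le> emeasure (interval_measure F) V"
      by (rule large_slope_cover[OF V(1,2) _ large]) (use assms in auto)
    also have "\<dots> \<le> ennreal p * ennreal (m + \<epsilon>)"
      using V(3) U' by (meson mult_left_mono order_trans zero_le)
    also have "\<dots> = ennreal (p * (m + \<epsilon>))"
      using m \<epsilon> assms by (simp add: ennreal_mult del: ennreal_plus)
    finally have "q * m \<le> p * (m + \<epsilon>)"
      using m \<epsilon> assms by (subst (asm) ennreal_le_iff) auto
    then show ?thesis using \<epsilon>(2) by (simp add: algebra_simps)
  qed
  then have "q * m \<le> p * m" by (rule field_le_epsilon)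
  then have "m = 0" using assms(3) m(2) by (metis mult_less_cancel_right_pos not_le order_le_less)
  then show ?thesis using m by (intro null_sets_lebesgue_outer) simp
qed

text \<open>With arbitrarily steep intervals at each point, \<open>q\<close> times the outer measure
  of \<open>E\<close> stays below the fixed increment of \<open>F\<close> over [-c, c] for every q
  \<ge> 0.\<close>

lemma null_infinite_slope:
  assumes "E \<subseteq> {-c<..<c}" "0 \<le> c"
    and large: "\<And>q x d. x \<in> E \<Longrightarrow> d > 0 \<Longrightarrow>
      \<exists>u v. u < v \<and> x \<in> {u..v} \<and> v - u < d \<and> q * (v - u) \<le> F v - F u"
  shows "E \<in> null_sets lebesgue"
proof -
  define m where "m = enn2real (outer_measure_of lborel E)"
  have m: "outer_measure_of lborel E = ennreal m" "m \<ge> 0"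
    using outer_measure_bounded_finite[of E c] assms(1) by (force simp: m_def)+
  have M: "F c - F (-c) \<ge> 0" using mono_F assms(2) by (auto simp: mono_def)
  have *: "q * m \<le> F c - F (-c)" if "q \<ge> 0" for q
  proof -
    have "E - {-c<..<c} \<in> null_sets lebesgue"
      using assms(1) by (simp add: Diff_eq_empty_iff[THEN iffD2])
    then have "ennreal q * outer_measure_of lborel E \<le> emeasure (interval_measure F) {-c<..<c}"
      by (intro large_slope_cover[OF _ _ that large]) auto
    also have "\<dots> \<le> emeasure (interval_measure F) {-c..c}"
      by (rule emeasure_mono) auto
    also have "\<dots> = ennreal (F c - F (-c))" using assms by (intro emeasure_Icc) auto
    finally show ?thesis using m that M by (simp add: ennreal_mult[symmetric])
  qed
  have "m = 0"
  proof (rule ccontr)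
    assume "m \<noteq> 0"
    \<comment> \<open>This \<open>q\<close> turns the bound into F c - F (-c) + 1 \<le> F c - F
      (-c).\<close>
    then show False using *[of "(F c - F (-c) + 1) / m"] m(2) M by simp
  qed
  then show ?thesis using m by (intro null_sets_lebesgue_outer) simp
qed

section \<open>Almost everywhere differentiability from lower and upper derivatives\<close>

text \<open>At a point of non-differentiability either the upper derivative is infinite or two
  rationals separate the lower from the upper derivative. Both cases lie in countable unions of the
  null sets above.\<close>

lemma differentiable_AE: "AE x in lebesgue. F differentiable (at x)"
proof -
  define lo where "lo p x \<longleftrightarrow> (\<forall>d>0. \<exists>u v. u < v \<and> x \<in> {u..v} \<and> v - u < d \<and> F v - F u \<le> p * (v - u))"
    for p x
  define hi where "hi q x \<longleftrightarrow> (\<forall>d>0. \<exists>u v. u < v \<and> x \<in> {u..v} \<and> v - u < d \<and> q * (v - u) \<le> F v - F u)"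
    for q x
  \<comment> \<open>The index \<open>n\<close> cuts the line into bounded pieces. \<open>B'\<close>
    uses open intervals, which serve directly as the open set in
    \<open>null_infinite_slope\<close>.\<close>
  define B where "B n p q = {x \<in> {-real n..real n}. lo p x \<and> hi q x}" for n p q
  define B' where "B' n = {x \<in> {-real n<..<real n}. \<forall>q. hi q x}" for n
  define I where "I = {(p, q). p \<in> \<rat> \<and> q \<in> \<rat> \<and> 0 \<le> p \<and> p < (q::real)}"
  have "countable I"
    by (rule countable_subset[of _ "\<rat> \<times> \<rat>"]) (auto simp: I_def countable_rat)
  then have "(\<Union>n. \<Union>i\<in>I. B n (fst i) (snd i)) \<in> null_sets lebesgue"
    by (intro null_sets_UN null_sets_UN')
      (auto simp: B_def I_def lo_def hi_def intro!: null_two_slopes)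
  moreover have "(\<Union>n. B' n) \<in> null_sets lebesgue"
    by (intro null_sets_UN) (auto simp: B'_def hi_def intro!: null_infinite_slope)
  ultimately have N: "(\<Union>n. \<Union>i\<in>I. B n (fst i) (snd i)) \<union> (\<Union>n. B' n) \<in> null_sets lebesgue"
    by (rule null_sets.Un)
  show ?thesis
  proof (rule AE_I'[OF N], safe)
    fix x assume nB': "x \<notin> (\<Union>n. B' n)" and nd: "\<not> F differentiable at x"
    define Q where "Q y = (F y - F x) / (y - x)" for y
    have Q_nonneg: "Q y \<ge> 0" for y
      using mono_F by (cases "y \<le> x") (auto simp: Q_def mono_def divide_nonpos_nonpos zero_le_divide_iff)
    have lo: "lo p x" if "\<exists>\<^sub>F y in at x. Q y < p" for p
      unfolding lo_def
    proof (intro allI impI)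
      fix d :: real assume "d > 0"
      have "\<exists>\<^sub>F y in at x. Q y < p \<and> (y \<noteq> x \<and> dist y x < d)"
        by (rule frequently_eventually_frequently[OF that])
          (use \<open>d > 0\<close> in \<open>auto simp: eventually_at intro!: exI[of _ d]\<close>)
      then obtain y where "Q y < p" "y \<noteq> x" "dist y x < d"
        by (auto dest: frequently_ex)
      then show "\<exists>u v. u < v \<and> x \<in> {u..v} \<and> v - u < d \<and> F v - F u \<le> p * (v - u)"
        \<comment> \<open>The interval between \<open>x\<close> and \<open>y\<close> has slope
          exactly \<open>Q y\<close>, on whichever side \<open>y\<close> lies.\<close>
        by (intro exI[of _ "min x y"] exI[of _ "max x y"])
          (auto simp: Q_def dist_real_def min_def max_def field_simps split: if_splits)
    qed
    have hi: "hi q x" if "\<exists>\<^sub>F y in at x. q < Q y" for q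
      unfolding hi_def
    proof (intro allI impI)
      fix d :: real assume "d > 0"
      have "\<exists>\<^sub>F y in at x. q < Q y \<and> (y \<noteq> x \<and> dist y x < d)"
        by (rule frequently_eventually_frequently[OF that])
          (use \<open>d > 0\<close> in \<open>auto simp: eventually_at intro!: exI[of _ d]\<close>)
      then obtain y where "q < Q y" "y \<noteq> x" "dist y x < d"
        by (auto dest: frequently_ex)
      then show "\<exists>u v. u < v \<and> x \<in> {u..v} \<and> v - u < d \<and> q * (v - u) \<le> F v - F u"
        by (intro exI[of _ "min x y"] exI[of _ "max x y"])
          (auto simp: Q_def dist_real_def min_def max_def field_simps split: if_splits)
    qed
    obtain n where n: "\<bar>x\<bar> < real n" using reals_Archimedean2 by blast
    define L H where "L = Liminf (at x) (\<lambda>y. ereal (Q y))" and "H = Limsup (at x) (\<lambda>y. ereal (Q y))"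
    have freq_lo: "\<exists>\<^sub>F y in at x. Q y < p" if "L < ereal p" for p
      using that Liminf_bounded[of "ereal p" "\<lambda>y. ereal (Q y)" "at x"]
      by (auto simp: L_def frequently_def not_less)
    have freq_hi: "\<exists>\<^sub>F y in at x. q < Q y" if "ereal q < H" for q
      using that Limsup_bounded[of "\<lambda>y. ereal (Q y)" "ereal q" "at x"]
      by (auto simp: H_def frequently_def not_less)
    have "0 \<le> L" unfolding L_def by (rule Liminf_bounded) (use Q_nonneg in auto)
    have "L \<le> H" unfolding L_def H_def by (rule Liminf_le_Limsup) simp
    have "H \<noteq> \<infinity>"
    proof
      assume "H = \<infinity>"
      then have "x \<in> B' n" using n hi freq_hi by (auto simp: B'_def)
      then show False using nB' by blast
    qed
    have "L < H"
    proof (rule ccontr)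
      assume "\<not> L < H"
      with \<open>L \<le> H\<close> have "L = H" by simp
      \<comment> \<open>The common value is finite, so it is a genuine limit of the quotients and
        hence a derivative.\<close>
      with \<open>H \<noteq> \<infinity>\<close> \<open>0 \<le> L\<close> obtain l where l: "L = ereal l" "H = ereal l" by (cases L) auto
      have "((\<lambda>y. ereal (Q y)) \<longlongrightarrow> ereal l) (at x)"
        by (rule Liminf_eq_Limsup) (use l in \<open>auto simp: L_def H_def\<close>)
      then have "(F has_field_derivative l) (at x)"
        by (simp add: has_field_derivative_iff Q_def)
      with nd show False by (auto simp: real_differentiable_def)
    qed
    \<comment> \<open>\<open>L\<close> and \<open>H\<close> are extended reals, whereas rational
      density is used between reals. The chain is L < r < p < p' < q < q' < H, with \<open>p\<close>
      and \<open>q\<close> rational.\<close>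
    then obtain q' where q': "L < ereal q'" "ereal q' < H" using ereal_dense2 by blast
    then obtain p' where p': "L < ereal p'" "ereal p' < ereal q'" using ereal_dense2 by blast
    obtain r where r: "L < ereal r" "ereal r < ereal p'" using ereal_dense2 p' by blast
    obtain p where p: "p \<in> \<rat>" "r < p" "p < p'" using Rats_dense_in_real r by force
    obtain q where q: "q \<in> \<rat>" "p' < q" "q < q'" using Rats_dense_in_real p' by force
    have Lp: "L < ereal p" using r p by (meson less_ereal.simps(1) less_trans)
    have qH: "ereal q < H" using q' q by (meson less_ereal.simps(1) less_trans)
    have "0 \<le> p" using \<open>0 \<le> L\<close> Lp by (metis ereal_less(2) le_less_trans less_imp_le ereal_less_eq(3) zero_ereal_def)
    then have "(p, q) \<in> I" using p q by (auto simp: I_def)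
    moreover have "x \<in> B n p q"
      using n lo[OF freq_lo[OF Lp]] hi[OF freq_hi[OF qH]] by (auto simp: B_def)
    ultimately show "x \<in> (\<Union>n. \<Union>i\<in>I. B n (fst i) (snd i))"
      by force
  qed
qed

end

section \<open>Projection onto a closed convex set along a ray\<close>

lemma closest_point_ray:
  fixes K :: "'a::euclidean_space set" and m h :: 'a
  assumes "closed K" "convex K" "K \<noteq> {}" "0 \<le> s" "s < t"
  defines "P \<equiv> \<lambda>\<sigma>. norm (closest_point K (m + \<sigma> *\<^sub>R h) - m)"
  shows "P s \<le> P t" "s * P t \<le> t * P s"
proof -
  define a b where "a = closest_point K (m + s *\<^sub>R h) - m" and "b = closest_point K (m + t *\<^sub>R h) - m"
  have in_K: "closest_point K x \<in> K" for x
    using assms by (simp add: closest_point_exists(1))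
  have 1: "(s *\<^sub>R h - a) \<bullet> (b - a) \<le> 0"
    using closest_point_dot[OF assms(2,1) in_K[of "m + t *\<^sub>R h"], of "m + s *\<^sub>R h"]
    by (simp add: a_def b_def algebra_simps)
  have 2: "(t *\<^sub>R h - b) \<bullet> (a - b) \<le> 0"
    using closest_point_dot[OF assms(2,1) in_K[of "m + s *\<^sub>R h"], of "m + t *\<^sub>R h"]
    by (simp add: a_def b_def algebra_simps)
  \<comment> \<open>With these weights the terms in \<open>h\<close> become opposite multiples s * t
    of h \<bullet> (b - a) and cancel.\<close>
  have "t * ((s *\<^sub>R h - a) \<bullet> (b - a)) + s * ((t *\<^sub>R h - b) \<bullet> (a - b)) \<le> 0"
    using 1 2 assms(4,5) by (intro add_nonpos_nonpos) (auto simp: mult_nonneg_nonpos)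
  then have "t * (a \<bullet> a) + s * (b \<bullet> b) \<le> (s + t) * (a \<bullet> b)"
    by (simp add: inner_diff_left inner_diff_right algebra_simps inner_commute)
  also have "\<dots> \<le> (s + t) * (norm a * norm b)"
    using assms(4,5) by (intro mult_left_mono norm_cauchy_schwarz) auto
  finally have *: "0 \<le> (norm b - norm a) * (t * norm a - s * norm b)"
    by (simp add: power2_norm_eq_inner[symmetric] power2_eq_square algebra_simps)
  show le: "P s \<le> P t"
  proof (rule ccontr)
    assume "\<not> P s \<le> P t"
    then have ba: "norm b < norm a" by (simp add: P_def a_def b_def)
    \<comment> \<open>A negative first factor forces the second to be nonpositive; this contradicts
      s < t, as \<open>norm a\<close> is positive.\<close>
    with * have "t * norm a \<le> s * norm b" by (auto simp: zero_le_mult_iff)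
    also have "\<dots> \<le> s * norm a" using ba assms(4) by (intro mult_left_mono) auto
    finally have "norm a \<le> 0" using assms(5) by (simp add: mult_le_cancel_right)
    with ba norm_ge_zero[of b] show False by linarith
  qed
  show "s * P t \<le> t * P s"
  \<comment> \<open>Equal norms make the product vanish and carry no information, but then the claim
    is just s \<le> t times the common norm.\<close>
  proof (cases "norm a = norm b")
    case True
    then show ?thesis using assms(5) by (auto simp: P_def a_def b_def intro: mult_right_mono)
  next
    case False
    with le have "norm a < norm b" by (simp add: P_def a_def b_def)
    with * show ?thesis by (auto simp: P_def a_def b_def zero_le_mult_iff)
  qed
qed

section \<open>Monotonicity of the error and the derivative bounds\<close>

text \<open>Differentiability is asserted explicitly because \<open>deriv\<close> is total and the
  bounds on it say nothing at points without a derivative. The upper bound comes from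
  differentiating the non-increasing ratio.\<close>

theorem lemma4p1:
  fixes K :: "(real ^ 'n) set" and \<mu>\<^sub>0 h :: "real ^ 'n"
  assumes "closed K" and "convex K" and "\<mu>\<^sub>0 \<in> K"
  shows "mono_on {0..} (proj_err K \<mu>\<^sub>0 h) \<and>
    (AE \<sigma> in lebesgue. \<sigma> > 0 \<longrightarrow>
       proj_err K \<mu>\<^sub>0 h differentiable (at \<sigma>) \<and>
       0 \<le> deriv (proj_err K \<mu>\<^sub>0 h) \<sigma> \<and>
       deriv (proj_err K \<mu>\<^sub>0 h) \<sigma> \<le> 2 * proj_err K \<mu>\<^sub>0 h \<sigma> / \<sigma>) \<and>
    antimono_on {0<..} (\<lambda>\<sigma>. proj_err K \<mu>\<^sub>0 h \<sigma> / \<sigma>\<^sup>2)"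
proof -
  let ?e = "proj_err K \<mu>\<^sub>0 h"
  have ne: "K \<noteq> {}" using assms by auto
  note ray = closest_point_ray[OF assms(1,2) ne, of _ _ \<mu>\<^sub>0 h]
  have mono: "mono_on {0..} ?e"
  proof (rule mono_onI)
    fix s t :: real assume "s \<in> {0..}" "s \<le> t"
    then show "?e s \<le> ?e t"
      using ray(1)[of s t] by (cases "s = t") (auto simp: proj_err_def power_mono)
  qed
  have antimono: "antimono_on {0<..} (\<lambda>\<sigma>. ?e \<sigma> / \<sigma>\<^sup>2)"
  proof (rule monotone_onI)
    fix s t :: real assume st: "s \<in> {0<..}" "t \<in> {0<..}" "s \<le> t"
    show "?e t / t\<^sup>2 \<le> ?e s / s\<^sup>2"
    proof (cases "s = t")
      case False
      then have "(s * norm (closest_point K (\<mu>\<^sub>0 + t *\<^sub>R h) - \<mu>\<^sub>0))\<^sup>2 \<le>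
          (t * norm (closest_point K (\<mu>\<^sub>0 + s *\<^sub>R h) - \<mu>\<^sub>0))\<^sup>2"
        using ray(2)[of s t] st by (intro power_mono) auto
      then show ?thesis
        using st by (simp add: proj_err_def power_mult_distrib field_simps)
    qed simp
  qed
  \<comment> \<open>Constant extension to the negative axis gives a function that is monotone and
    continuous on the whole line and agrees with the error for \<sigma> > 0.\<close>
  define G where "G \<sigma> = ?e (max 0 \<sigma>)" for \<sigma>
  have "continuous_on UNIV G"
    unfolding G_def proj_err_def
    by (intro continuous_intros continuous_on_compose2[OF continuous_on_closest_point[OF assms(2,1) ne]]) auto
  moreover have "mono G"
    using mono by (auto simp: G_def mono_def mono_on_def)
  ultimately interpret G: continuous_mono G by unfold_locales
  have "AE \<sigma> in lebesgue. \<sigma> > 0 \<longrightarrow>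
       ?e differentiable (at \<sigma>) \<and> 0 \<le> deriv ?e \<sigma> \<and> deriv ?e \<sigma> \<le> 2 * ?e \<sigma> / \<sigma>"
    using G.differentiable_AE
  proof eventually_elim
    case (elim \<sigma>)
    show ?case
    proof
      assume \<sigma>: "\<sigma> > 0"
      obtain D where "(G has_field_derivative D) (at \<sigma>)"
        using elim by (auto simp: real_differentiable_def)
      then have D: "(?e has_field_derivative D) (at \<sigma>)"
        by (rule has_field_derivative_transform_within_open[where S = "{0<..}"])
          (use \<sigma> in \<open>auto simp: G_def\<close>)
      have "D \<ge> 0"
        using mono_on_imp_deriv_nonneg[OF mono D] \<sigma> by simp
      \<comment> \<open>The ratio is negated so that the sign criterion for non-decreasing functions
        applies; the sign of this derivative then gives D * \<sigma> \<le> 2 *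
        err(\<sigma>).\<close>
      have ratio: "((\<lambda>\<sigma>. - (?e \<sigma> / \<sigma>\<^sup>2)) has_field_derivative
          - ((D * \<sigma>\<^sup>2 - ?e \<sigma> * (2 * \<sigma>)) / (\<sigma>\<^sup>2 * \<sigma>\<^sup>2))) (at \<sigma>)"
        using \<sigma> D by (auto intro!: derivative_eq_intros)
      have "mono_on {0<..} (\<lambda>\<sigma>. - (?e \<sigma> / \<sigma>\<^sup>2))"
        using antimono by (auto simp: monotone_on_def)
      then have "0 \<le> - ((D * \<sigma>\<^sup>2 - ?e \<sigma> * (2 * \<sigma>)) / (\<sigma>\<^sup>2 * \<sigma>\<^sup>2))"
        by (rule mono_on_imp_deriv_nonneg[OF _ ratio]) (use \<sigma> in \<open>simp add: interior_open\<close>)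
      then have "(D * \<sigma>\<^sup>2 - ?e \<sigma> * (2 * \<sigma>)) \<le> 0"
        using \<sigma> by (simp add: divide_le_0_iff)
      then have "\<sigma> * (D * \<sigma>) \<le> \<sigma> * (2 * ?e \<sigma>)"
        by (simp add: power2_eq_square algebra_simps)
      then have "D \<le> 2 * ?e \<sigma> / \<sigma>"
        using \<sigma> by (simp add: field_simps)
      with \<open>D \<ge> 0\<close> D show "?e differentiable (at \<sigma>) \<and> 0 \<le> deriv ?e \<sigma> \<and> deriv ?e \<sigma> \<le> 2 * ?e \<sigma> / \<sigma>"
        by (auto simp: DERIV_imp_deriv[OF D] real_differentiable_def)
    qed
  qed
  with mono antimono show ?thesis by blast
qed

end
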